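(* Let $(\alpha_n,\beta_n)_{n\in\mathbb{Z}}$ be a bilateral Bailey pair relative to $a$, let $N\geq0$ be an integer and $\rho,\sigma$ complex parameters. Define for $n\in\mathbb{Z}$ \[ \alpha'_n=\frac{(\rho,\sigma)_n(aq^{1-N}/\rho\sigma)^n}{(aq^{1-N}/\rho,aq^{1-N}/\sigma)_n}(1-aq^{2n-N})(aq^{1-N})_N\sum_{j=0}^N(-1)^j\frac{a^jq^{(2n-N)j-j(j+1)/2}}{(aq^{2n-N-j})_{N+1}}\begin{bmatrix}N\\ j\end{bmatrix}\alpha_{n-j}, \] \[ \beta'_n=\sum_{j\le n}\frac{(\rho,\sigma)_j(aq^{1-N}/\rho\sigma)_{n-j}(aq^{1-N}/\rho\sigma)^j}{(q)_{n-j}(aq^{1-N}/\rho,aq^{1-N}/\sigma)_n}\beta_j . \] Then, subject to convergence conditions on $\alpha_n,\beta_n$ making all the relevant infinite series absolutely convergent, $(\alpha'_n,\beta'_n)$ is a bilateral Bailey pair relative to $aq^{-N}$.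
   Context: Fix complex numbers $a,q$ with $|q|<1$ (parameters generic so that no denominator vanishes). For complex $x$, $(x)_\infty=\prod_{j\ge0}(1-xq^j)$ and for $k\in\mathbb{Z}$, $(x)_k=(x)_\infty/(xq^k)_\infty$ (so $1/(q)_k=0$ for $k<0$); $(x_1,\dots,x_m)_k=(x_1)_k\cdots(x_m)_k$. A bilateral Bailey pair relative to $c$ is a pair of sequences $(\alpha_n)_{n\in\mathbb{Z}},(\beta_n)_{n\in\mathbb{Z}}$ such that for every $n\in\mathbb{Z}$, $\beta_n=\sum_{j\le n}\frac{\alpha_j}{(q)_{n-j}(cq)_{n+j}}$ (the series being convergent). For integers $N\ge0$ and $j$, $\begin{bmatrix}N\\ j\end{bmatrix}=\frac{(q)_N}{(q)_j(q)_{N-j}}$ if $0\le j\le N$ and $0$ otherwise. *)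

theory Defs
  imports "HOL-Analysis.Analysis"
begin

definition qpoch_inf :: "complex \<Rightarrow> complex \<Rightarrow> complex" where
  "qpoch_inf q x = (\<Prod>j. 1 - x * q ^ j)"

text \<open>
  For \<open>k < 0\<close> the denominator of \<open>qpoch q q k\<close> is zero, so \<open>qpoch q q k = 0\<close> and
  \<open>1 / qpoch q q k = 0\<close> by the convention \<open>x / 0 = 0\<close>; this agrees with the usual
  convention for \<open>1 / (q)\<^sub>k\<close>.
\<close>

definition qpoch :: "complex \<Rightarrow> complex \<Rightarrow> int \<Rightarrow> complex" where
  "qpoch q x k = qpoch_inf q x / qpoch_inf q (x * q powi k)"

definition qbinom :: "complex \<Rightarrow> nat \<Rightarrow> int \<Rightarrow> complex" where
  "qbinom q N j =
     (if 0 \<le> j \<and> j \<le> int N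
      then qpoch q q (int N) / (qpoch q q j * qpoch q q (int N - j)) else 0)"

definition bailey_term ::
  "complex \<Rightarrow> complex \<Rightarrow> (int \<Rightarrow> complex) \<Rightarrow> int \<Rightarrow> int \<Rightarrow> complex" where
  "bailey_term q c \<alpha> n j = \<alpha> j / (qpoch q q (n - j) * qpoch q (c * q) (n + j))"

text \<open>
  The series over all integers \<open>j \<le> n\<close> is an ordinary (possibly only conditionally)
  convergent series, summed in the order \<open>j = n, n - 1, n - 2, \<dots>\<close>.
\<close>

definition bilateral_bailey_pair ::
  "complex \<Rightarrow> complex \<Rightarrow> (int \<Rightarrow> complex) \<Rightarrow> (int \<Rightarrow> complex) \<Rightarrow> bool" where
  "bilateral_bailey_pair q c \<alpha> \<beta> \<longleftrightarrow>
     (\<forall>n. (\<lambda>k. bailey_term q c \<alpha> n (n - int k)) sums \<beta> n)"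

end

theory Submission
  imports Defs
begin

text \<open>
  Put \<open>b = a q\<^sup>-\<^sup>N\<close>. The new pair arises in two steps. First the base is changed from \<open>a\<close> to \<open>b\<close>
  without changing \<open>\<beta>\<close>: the coefficient \<open>1 / ((q)\<^bsub>j-r\<^esub> (aq)\<^bsub>j+r\<^esub>)\<close> of \<open>\<alpha>\<^sub>r\<close> in \<open>\<beta>\<^sub>j\<close> is a
  combination of the coefficients relative to \<open>b\<close> at \<open>r, \<dots>, r + N\<close>, by a terminating
  very-well-poised sum. Then the bilateral Bailey lemma relative to \<open>b\<close> applies, which is the
  q-Saalschuetz sum. Both finite sums are proved by telescoping with explicit certificates.

  Interchanging the summations is licensed by the absolute convergence of the double series.
  Splitting the outcome into its \<open>N + 1\<close> shifted series needs each of them to converge absolutely: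
  the \<open>i\<close>-th one is dominated by the diagonal \<open>j = r + i\<close> of the double series, because the
  quotient of the coefficients has successive ratios tending to \<open>0\<close>.
\<close>

section \<open>Finite q-shifted factorials and their reciprocals\<close>

definition qfac :: "complex \<Rightarrow> complex \<Rightarrow> nat \<Rightarrow> complex" where
  "qfac q x k = (\<Prod>i<k. 1 - x * q ^ i)"

text \<open>The reciprocal of \<open>(q)_k\<close> is extended to all integers by 0 for
  \<open>k < 0\<close>, so terms outside the natural range of a sum vanish by themselves.\<close>

definition inv_qfac :: "complex \<Rightarrow> int \<Rightarrow> complex" where
  "inv_qfac q k = (if k < 0 then 0 else 1 / qfac q q (nat k))"

lemma qfac_0 [simp]: "qfac q x 0 = 1"
  by (simp add: qfac_def)

lemma qfac_Suc: "qfac q x (Suc k) = qfac q x k * (1 - x * q ^ k)"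
  by (simp add: qfac_def)

lemma qfac_add: "qfac q x (k + l) = qfac q x k * qfac q (x * q ^ k) l"
  by (induction l) (simp_all add: qfac_Suc power_add algebra_simps)

lemma qfac_nonzero:
  assumes "\<And>i. i < k \<Longrightarrow> x * q ^ i \<noteq> 1"
  shows "qfac q x k \<noteq> 0"
  using assms by (auto simp: qfac_def)

lemma one_minus_power_nonzero:
  fixes q :: complex
  assumes "norm q < 1"
  shows "1 - q * q ^ k \<noteq> 0"
proof
  assume "1 - q * q ^ k = 0"
  then have "q ^ Suc k = 1" by simp
  then have "norm q ^ Suc k = 1" by (metis norm_one norm_power)
  moreover have "norm q ^ Suc k < 1"
    using assms by (simp only: power_less_one_iff norm_ge_zero) simp
  ultimately show False by simp
qed

lemma qfac_q_nonzero: "norm q < 1 \<Longrightarrow> qfac q q k \<noteq> 0"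
  using one_minus_power_nonzero by (intro qfac_nonzero) force

lemma inv_qfac_nat: "inv_qfac q (int k) = 1 / qfac q q k"
  by (simp add: inv_qfac_def)

lemma inv_qfac_neg: "k < 0 \<Longrightarrow> inv_qfac q k = 0"
  by (simp add: inv_qfac_def)

text \<open>At \<open>k = -1\<close> the factor on the right is zero, and below that both
  reciprocals are zero. The recurrence therefore has no boundary exceptions, and the telescoping of
  the very-well-poised sum can treat all indices alike.\<close>

lemma inv_qfac_rec:
  assumes "q \<noteq> 0" "norm q < 1"
  shows "inv_qfac q k = (1 - q powi (k + 1)) * inv_qfac q (k + 1)"
proof -
  consider "k < -1" | "k = -1" | "k \<ge> 0" by linarith
  then show ?thesis
  proof cases
    case 3
    then obtain n where n: "k = int n" using zero_le_imp_eq_int by blast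
    have e: "int n + 1 = int (Suc n)" by simp
    show ?thesis
      unfolding n e inv_qfac_nat power_int_of_nat
      using qfac_q_nonzero[OF assms(2), of n] one_minus_power_nonzero[OF assms(2), of n]
      by (simp add: qfac_Suc)
  qed (auto simp: inv_qfac_def)
qed

subsection \<open>The q-Saalschuetz sum\<close>

text \<open>For generic parameters, rewriting the factors of index \<open>M - k\<close> through
  \<open>q^(-M)\<close> gives \<open>(X)_M / (q)_M\<close> times the balanced terminating 3phi2 with
  upper parameters \<open>R, S, q^(-M)\<close> and lower parameters
  \<open>R S X, q^(1-M) / X\<close>. The form used here is free of negative powers and is proved by
  induction on \<open>M\<close>.\<close>

lemma q_Saalschuetz:
  assumes q: "norm q < 1" and c: "\<And>i. R * S * X * q ^ i \<noteq> 1"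
  shows "(\<Sum>k\<le>M. qfac q R k * qfac q S k * qfac q X (M - k) * X ^ k
            / (qfac q q (M - k) * qfac q q k * qfac q (R * S * X) k))
         = qfac q (S * X) M * qfac q (R * X) M / (qfac q q M * qfac q (R * S * X) M)"
proof (induction M)
  case 0
  show ?case by simp
next
  case (Suc M)
  define c where "c = R * S * X"
  define f where "f M k = qfac q R k * qfac q S k * qfac q X (M - k) * X ^ k
     / (qfac q q (M - k) * qfac q q k * qfac q c k)" for M k
  define H where "H k = - (q ^ (M - k) * qfac q R (Suc k) * qfac q S (Suc k) * qfac q X (M - k)
     * X ^ Suc k / (qfac q q (M - k) * qfac q q k * qfac q c k))" for k
  define D where "D k = (1 - q * q ^ M) * (1 - c * q ^ M) * f (Suc M) k
     - (1 - S * X * q ^ M) * (1 - R * X * q ^ M) * f M k" for k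
  have cn: "1 - c * q ^ i \<noteq> 0" for i using assms(2) by (simp add: c_def)
  have cf: "qfac q c i \<noteq> 0" for i using qfac_nonzero[of i c q] assms(2) by (simp add: c_def)
  note nz = cn cf qfac_q_nonzero[OF q] one_minus_power_nonzero[OF q]
  \<comment> \<open>\<open>H\<close> is the q-Zeilberger certificate of the first-order recurrence in \<open>M\<close>.\<close>
  have collect: "A * (K * B) - C * (K * E) - (- (K * F) - - (K * G)) = K * (A * B - C * E + F - G)"
    for A B C E F G K :: complex by (simp add: algebra_simps)
  have step: "D (Suc k) = H (Suc k) - H k" if le: "Suc k \<le> M" for k
  proof -
    obtain d where d: "M = Suc k + d" using le_Suc_ex[OF le] by auto
    \<comment> \<open>\<open>K\<close> combines the shortest numerator products with the longest
      denominator products among the two summands and the two values of \<open>H\<close>. Each of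
      these is then \<open>K\<close> times a polynomial in \<open>y\<close>, \<open>z\<close> and
      the parameters.\<close>
    define K where "K = qfac q R (Suc k) * qfac q S (Suc k) * qfac q X d * X ^ Suc k
       / (qfac q q (Suc d) * qfac q q (Suc k) * qfac q c (Suc k))"
    define y z where "y = q ^ k" and "z = q ^ d"
    have M: "q ^ M = q * y * z" by (simp add: d y_def z_def power_add)
    have s1: "Suc M - Suc k = Suc d" "M - Suc k = d" "M - k = Suc d" by (simp_all add: d)
    have a1: "f (Suc M) (Suc k) = K * (1 - X * z)"
      unfolding f_def K_def s1 z_def by (simp add: qfac_Suc)
    have a2: "f M (Suc k) = K * (1 - q * z)"
      unfolding f_def K_def s1 z_def using nz by (simp add: qfac_Suc mult_ac)
    have a3: "H (Suc k) = - (K * ((1 - q * z) * z * X * (1 - R * q * y) * (1 - S * q * y)))"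
      unfolding H_def K_def s1 z_def y_def using nz
      by (simp add: qfac_Suc[of q _ "Suc k"] qfac_Suc[of q _ d] mult_ac)
    have a4: "H k = - (K * ((1 - X * z) * q * z * (1 - q * y) * (1 - c * y)))"
      unfolding H_def K_def s1 z_def y_def using nz
      by (simp add: qfac_Suc[of q q k] qfac_Suc[of q c k] qfac_Suc[of q X d] mult_ac)
    have "D (Suc k) - (H (Suc k) - H k)
      = K * ((1 - q * (q * y * z)) * (1 - c * (q * y * z)) * (1 - X * z)
             - (1 - S * X * (q * y * z)) * (1 - R * X * (q * y * z)) * (1 - q * z)
             + (1 - q * z) * z * X * (1 - R * q * y) * (1 - S * q * y)
             - (1 - X * z) * q * z * (1 - q * y) * (1 - c * y))"
      unfolding D_def M a1 a2 a3 a4 by (rule collect)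
    also have "\<dots> = 0" unfolding c_def by (simp add: algebra_simps)
    finally show ?thesis by simp
  qed
  \<comment> \<open>Telescoping from index 0. The base case \<open>D 0 = H 0\<close> is the
    certificate equation with the value 0 for \<open>H\<close> at index -1, and needs its own check
    because indices are natural numbers.\<close>
  have partial: "(\<Sum>k\<le>K. D k) = H K" if "K \<le> M" for K
    using that
  proof (induction K)
    case 0
    define K where "K = qfac q X M / qfac q q (Suc M)"
    have "f (Suc M) 0 = K * (1 - X * q ^ M)" "f M 0 = K * (1 - q * q ^ M)"
      "H 0 = - (K * (1 - q * q ^ M) * q ^ M * (1 - R) * (1 - S) * X)"
      using nz by (simp_all add: f_def H_def K_def qfac_Suc mult_ac)
    then have "D 0 - H 0 = K * (1 - q * q ^ M) * ((1 - c * q ^ M) * (1 - X * q ^ M)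
        - (1 - S * X * q ^ M) * (1 - R * X * q ^ M) + q ^ M * (1 - R) * (1 - S) * X)"
      unfolding D_def by (simp only:) (simp add: algebra_simps)
    also have "\<dots> = 0" unfolding c_def by (simp add: algebra_simps)
    finally show ?case by simp
  next
    case (Suc K)
    then show ?case using step[of K] by simp
  qed
  \<comment> \<open>The sum for \<open>Suc M\<close> has one term more than the sum of
    \<open>D\<close>; that term cancels the telescoped value \<open>H M\<close>.\<close>
  have last: "(1 - q * q ^ M) * (1 - c * q ^ M) * f (Suc M) (Suc M) = - H M"
    unfolding f_def H_def using nz by (simp add: qfac_Suc[of q q M] qfac_Suc[of q c M] mult_ac)
  have "(1 - q * q ^ M) * (1 - c * q ^ M) * (\<Sum>k\<le>Suc M. f (Suc M) k)
    = (\<Sum>k\<le>M. D k) + (1 - S * X * q ^ M) * (1 - R * X * q ^ M) * (\<Sum>k\<le>M. f M k) - H M"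
    using last by (simp add: D_def sum_subtractf sum_distrib_left distrib_left)
  also have "\<dots> = (1 - S * X * q ^ M) * (1 - R * X * q ^ M) *
     (qfac q (S * X) M * qfac q (R * X) M / (qfac q q M * qfac q c M))"
    using Suc.IH partial[of M] by (simp add: f_def c_def)
  finally have "(\<Sum>k\<le>Suc M. f (Suc M) k) = qfac q (S * X) (Suc M) * qfac q (R * X) (Suc M)
     / (qfac q q (Suc M) * qfac q c (Suc M))"
    using nz by (simp add: qfac_Suc divide_simps mult_ac)
  then show ?case by (simp add: f_def c_def)
qed

subsection \<open>A terminating very-well-poised sum\<close>

text \<open>Up to normalisation this is the very-well-poised 6phi5 sum with two parameters
  \<open>q^(-N)\<close> and \<open>q^(-M)\<close> and the third sent to infinity, which produces the
  quadratic power of \<open>q\<close>. The induction is on \<open>N\<close> with \<open>M\<close>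
  fixed; terms with \<open>i > M\<close> vanish through \<open>inv_qfac\<close>.\<close>

lemma very_well_poised_sum:
  assumes q: "q \<noteq> 0" "norm q < 1" and B: "\<And>i. B * q ^ i \<noteq> 1"
  shows "(\<Sum>i\<le>N. (1 - B * q ^ (2 * i)) * qfac q B i * (- B) ^ i
            * q powi (2 * (int i)\<^sup>2 - int (i * (i + 1) div 2))
            * inv_qfac q (int i) * inv_qfac q (int N - int i) * inv_qfac q (int M - int i)
            / (qfac q B (N + 1 + i) * qfac q (B * q) (M + i)))
         = 1 / (qfac q q M * qfac q q N * qfac q (B * q) (M + N))"
proof (induction N)
  case 0
  then show ?case using B[of 0] by (simp add: inv_qfac_nat inv_qfac_def qfac_Suc)
next
  case (Suc N)
  define V where "V i = qfac q B i * (- B) ^ i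
            * q powi (2 * (int i)\<^sup>2 - int (i * (i + 1) div 2)) * inv_qfac q (int M - int i)" for i
  define t where "t N i = (1 - B * q ^ (2 * i)) * V i * inv_qfac q (int i) * inv_qfac q (int N - int i)
            / (qfac q B (N + 1 + i) * qfac q (B * q) (M + i))" for N i
  define G where "G i = - (q powi (int N + 1 - int i) * (1 - q ^ i) * inv_qfac q (int i) * V i
     * inv_qfac q (int N + 1 - int i) * (1 - B * q ^ (M + i))
     / (qfac q B (N + 1 + i) * qfac q (B * q) (M + i)))" for i
  \<comment> \<open>\<open>G\<close> is the q-Zeilberger certificate of the first-order recurrence in \<open>N\<close>.\<close>
  have Bn: "1 - B * q ^ i \<noteq> 0" for i using B by simp
  have Bn': "1 - B * q * q ^ i \<noteq> 0" for i using B[of "Suc i"] by (simp add: mult.assoc)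
  have Bf: "qfac q B i \<noteq> 0" for i using qfac_nonzero[of i B q] B by simp
  have Bf': "qfac q (B * q) i \<noteq> 0" for i using qfac_nonzero[of i "B * q" q] Bn' by simp
  \<comment> \<open>The exponent grows by \<open>3 * i + 1\<close>, which becomes the factor
    \<open>q * y ^ 3\<close> in the recurrence for \<open>V\<close>.\<close>
  have exp: "2 * (int (Suc i))\<^sup>2 - int (Suc i * (Suc i + 1) div 2)
     = 2 * (int i)\<^sup>2 - int (i * (i + 1) div 2) + int (3 * i + 1)" for i
  proof -
    have "Suc i * (Suc i + 1) div 2 = i * (i + 1) div 2 + (i + 1)"
    proof -
      have "Suc i * (Suc i + 1) = i * (i + 1) + 2 * (i + 1)" by simp
      then show ?thesis by (simp del: mult_Suc mult_Suc_right)
    qed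
    then show ?thesis by (simp add: power2_eq_square algebra_simps)
  qed
  have step: "(1 - q * q ^ N) * (1 - B * q * q ^ (M + N)) * t (Suc N) i - t N i = G (Suc i) - G i" for i
  proof -
    define y P m where "y = q ^ i" and "P = q * q ^ N" and "m = q ^ M"
    have y: "y \<noteq> 0" using q by (simp add: y_def)
    have 1: "q powi (int N + 1 - int i) = P / y"
      using q by (simp add: power_int_diff power_int_add P_def y_def)
    have 2: "q powi (int M - int i) = m / y"
      using q by (simp add: power_int_diff m_def y_def)
    have 3: "q powi (int N - int i) = P / (q * y)"
      using q by (simp add: power_int_diff P_def y_def)
    \<comment> \<open>Reciprocals of smaller index are written as multiples of those of larger
      index. This involves no division by a possibly vanishing factor, so the step holds for every
      \<open>i\<close>, also beyond \<open>N\<close>.\<close>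
    define w u where "w = inv_qfac q (int (Suc i))" and "u = inv_qfac q (int N + 1 - int i)"
    have w: "inv_qfac q (int i) = (1 - q * y) * w"
      using inv_qfac_rec[OF q, of "int i"] q by (simp add: w_def y_def power_int_add add.commute)
    have u: "inv_qfac q (int N - int i) = (1 - P / y) * u"
      using inv_qfac_rec[OF q, of "int N - int i"] 1 by (simp add: u_def algebra_simps)
    have u1: "inv_qfac q (int (Suc N) - int i) = u" by (simp add: u_def algebra_simps)
    have u2: "inv_qfac q (int N + 1 - int (Suc i)) = (1 - P / y) * u" using u by simp
    have V: "V (Suc i) = V i * (1 - B * y) * (- B) * (q * y ^ 3) * (1 - m / y)"
    proof -
      have "inv_qfac q (int M - int (Suc i)) = (1 - m / y) * inv_qfac q (int M - int i)"
        using inv_qfac_rec[OF q, of "int M - int (Suc i)"] 2 by (simp add: algebra_simps)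
      moreover have "q powi (2 * (int (Suc i))\<^sup>2 - int (Suc i * (Suc i + 1) div 2))
         = q powi (2 * (int i)\<^sup>2 - int (i * (i + 1) div 2)) * (q * y ^ 3)"
        unfolding exp using q
        by (subst power_int_add)
          (auto simp only: power_int_of_nat y_def power_add power_mult power_one_right power_commutes mult.commute)
      ultimately show ?thesis
        unfolding V_def by (simp only: qfac_Suc power_Suc y_def) (simp add: mult_ac)
    qed
    define K where "K = V i * w * u / (qfac q B (N + 2 + i) * qfac q (B * q) (M + i))"
    have D1: "x / (qfac q B (N + 1 + i) * F) = x * (1 - B * P * y) / (qfac q B (N + 2 + i) * F)" for x F
    proof -
      have "qfac q B (N + 2 + i) = qfac q B (N + 1 + i) * (1 - B * P * y)"
        by (simp add: qfac_Suc P_def y_def power_add mult_ac)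
      moreover have "1 - B * P * y \<noteq> 0"
        using Bn[of "N + 1 + i"] by (simp add: P_def y_def power_add mult_ac)
      ultimately show ?thesis by simp
    qed
    have D2: "x * (1 - B * q ^ (M + Suc i)) / (F * qfac q (B * q) (M + Suc i))
        = x / (F * qfac q (B * q) (M + i))" for x F
      using Bn[of "M + Suc i"] by (simp add: qfac_Suc mult_ac)
    have a1: "t (Suc N) i = K * (1 - q * y) * (1 - B * y^2)"
      unfolding t_def u1 w K_def by (simp add: y_def power_mult power2_eq_square power_mult_distrib mult_ac power_even_eq)
    have a2: "t N i = K * (1 - q * y) * (1 - P / y) * (1 - B * P * y) * (1 - B * y^2)"
      unfolding t_def u w K_def D1
      by (simp add: y_def power_mult power2_eq_square power_mult_distrib mult_ac power_even_eq)
    have a3: "G i = - K * (P / y) * (1 - y) * (1 - q * y) * (1 - B * P * y) * (1 - B * m * y)"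
      unfolding G_def 1 w u_def[symmetric] D1 K_def
      by (simp add: m_def y_def power_add mult_ac)
    have a4: "G (Suc i) = - K * (P / (q * y)) * (1 - q * y) * (1 - P / y) * (1 - B * y) * (- B) * (q * y ^ 3) * (1 - m / y)"
    proof -
      have e: "int N + 1 - int (Suc i) = int N - int i" "N + 1 + Suc i = N + 2 + i" "q ^ Suc i = q * y"
        by (simp_all add: y_def)
      show ?thesis
        unfolding G_def D2 V e 3 u w_def[symmetric] K_def by (simp add: mult_ac)
    qed
    have "(1 - q * q ^ N) * (1 - B * q * q ^ (M + N)) * t (Suc N) i - t N i - (G (Suc i) - G i)
     = K * (1 - q * y) * ((1 - P) * (1 - B * P * m) * (1 - B * y^2) - (1 - P / y) * (1 - B * P * y) * (1 - B * y^2)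
        + P / (q * y) * (1 - P / y) * (1 - B * y) * (- B) * (q * y ^ 3) * (1 - m / y)
        - P / y * (1 - y) * (1 - B * P * y) * (1 - B * m * y))"
      unfolding a1 a2 a3 a4 by (simp add: P_def m_def power_add) algebra
    also have "\<dots> = 0"
      using y q by (simp add: field_simps) algebra
    finally show ?thesis by simp
  qed
  have solve: "S = T / (u * v)" if "0 = u * v * S - T" "u \<noteq> 0" "v \<noteq> 0" for S T u v :: complex
    using that by (simp add: field_simps)
  \<comment> \<open>The sums for \<open>N\<close> and \<open>Suc N\<close> differ in length; the
    surplus term on the \<open>N\<close> side is zero.\<close>
  have "inv_qfac q (int N - int (Suc N)) = 0" by (simp add: inv_qfac_neg)
  then have t0: "t N (Suc N) = 0" by (simp add: t_def)
  \<comment> \<open>Both ends of the telescoping sum vanish: at 0 through \<open>1 - q ^ 0\<close>,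
    at \<open>N + 2\<close> through the reciprocal factorial of index -1.\<close>
  have "G 0 = 0" "G (Suc (Suc N)) = 0" by (simp_all add: G_def inv_qfac_neg)
  then have "0 = (\<Sum>i<Suc (Suc N). G (Suc i) - G i)" by (simp only: sum_lessThan_telescope) simp
  also have "\<dots> = (1 - q * q ^ N) * (1 - B * q * q ^ (M + N)) * (\<Sum>i\<le>Suc N. t (Suc N) i) - (\<Sum>i\<le>N. t N i)"
    using t0 by (simp only: step[symmetric] sum_subtractf sum_distrib_left lessThan_Suc_atMost) simp
  also have "(\<Sum>i\<le>N. t N i) = 1 / (qfac q q M * qfac q q N * qfac q (B * q) (M + N))"
    using Suc.IH by (simp add: t_def V_def mult_ac)
  finally have "(\<Sum>i\<le>Suc N. t (Suc N) i) = 1 / (qfac q q M * qfac q q N * qfac q (B * q) (M + N))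
      / ((1 - q * q ^ N) * (1 - B * q * q ^ (M + N)))"
    using Bn'[of "M + N"] one_minus_power_nonzero[OF q(2), of N]
    by (intro solve) auto
  then have "(\<Sum>i\<le>Suc N. t (Suc N) i) = 1 / (qfac q q M * qfac q q (Suc N) * qfac q (B * q) (M + Suc N))"
    by (simp add: qfac_Suc mult_ac del: sum.atMost_Suc)
  then show ?case by (simp add: t_def V_def mult_ac del: sum.atMost_Suc)
qed

subsection \<open>Quotients of infinite products\<close>

lemma convergent_prod_qpoch:
  assumes "norm q < 1"
  shows "convergent_prod (\<lambda>j. 1 - x * q ^ j :: complex)"
proof (rule abs_convergent_prod_imp_convergent_prod)
  have "summable (\<lambda>j. norm x * norm q ^ j)"
    using assms by (intro summable_mult summable_geometric) auto
  then show "abs_convergent_prod (\<lambda>j. 1 - x * q ^ j)"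
    by (simp add: abs_convergent_prod_conv_summable norm_mult norm_power)
qed

lemma qpoch_inf_rec:
  assumes "norm q < 1"
  shows "qpoch_inf q x = (1 - x) * qpoch_inf q (x * q)"
proof -
  have "(\<lambda>n. \<Prod>j\<le>Suc n. 1 - x * q ^ j) \<longlonglongrightarrow> qpoch_inf q x"
    unfolding qpoch_inf_def using convergent_prod_LIMSEQ[OF convergent_prod_qpoch[OF assms]]
    by (rule LIMSEQ_Suc)
  moreover have "(\<lambda>n. (1 - x) * (\<Prod>j\<le>n. 1 - x * q * q ^ j)) \<longlonglongrightarrow> (1 - x) * qpoch_inf q (x * q)"
    unfolding qpoch_inf_def
    by (intro tendsto_mult_left convergent_prod_LIMSEQ convergent_prod_qpoch assms)
  moreover have "(\<Prod>j\<le>Suc n. 1 - x * q ^ j) = (1 - x) * (\<Prod>j\<le>n. 1 - x * q * q ^ j)" for n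
    by (subst prod.atMost_Suc_shift) (simp add: mult_ac)
  ultimately show ?thesis by (simp add: LIMSEQ_unique)
qed

lemma qpoch_inf_split:
  assumes "norm q < 1"
  shows "qpoch_inf q x = qfac q x n * qpoch_inf q (x * q ^ n)"
proof (induction n)
  case (Suc n)
  then show ?case
    using qpoch_inf_rec[OF assms, of "x * q ^ n"] by (simp add: qfac_Suc mult_ac)
qed simp

lemma qpoch_inf_nonzero:
  assumes "norm q < 1" "\<And>k. x * q ^ k \<noteq> 1"
  shows "qpoch_inf q x \<noteq> 0"
  unfolding qpoch_inf_def using assms
  by (intro prodinf_nonzero convergent_prod_qpoch) auto

lemma qpoch_inf_eq_0:
  assumes "norm q < 1" "x * q ^ k = 1"
  shows "qpoch_inf q x = 0"
  using qpoch_inf_split[OF assms(1), of x "Suc k"] assms(2) by (simp add: qfac_Suc)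

lemma qpoch_nat:
  assumes "norm q < 1" "\<And>k. x * q ^ k \<noteq> 1"
  shows "qpoch q x (int k) = qfac q x k"
proof -
  have "qpoch_inf q (x * q ^ k) \<noteq> 0"
    using assms by (intro qpoch_inf_nonzero) (auto simp: mult.assoc simp flip: power_add)
  then show ?thesis
    using qpoch_inf_split[OF assms(1), of x k] by (simp add: qpoch_def)
qed

text \<open>For \<open>k < 0\<close> the infinite product in the denominator of \<open>qpoch\<close>
  contains a zero factor, and both sides become 0 by the convention for division by zero.\<close>

lemma qpoch_q:
  assumes "q \<noteq> 0" "norm q < 1"
  shows "qpoch q q k = 1 / inv_qfac q k"
proof (cases "k < 0")
  case True
  define j where "j = nat (- k - 1)"
  have "q * q powi k * q ^ j = q powi (1 + k + int j)"
    using assms by (simp add: power_int_add)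
  also have "\<dots> = 1" using True by (simp add: j_def)
  finally show ?thesis
    using qpoch_inf_eq_0[OF assms(2)] True by (simp add: qpoch_def inv_qfac_neg)
next
  case False
  then obtain n where n: "k = int n" using zero_le_imp_eq_int[of k] by auto
  show ?thesis
    using qpoch_nat[OF assms(2), of q n] one_minus_power_nonzero[OF assms(2)]
    by (force simp: n inv_qfac_nat)
qed

section \<open>Generic parameters and factorials of integer index\<close>

text \<open>Quantifying over all integers makes the condition stable under multiplication by powers
  of \<open>q\<close>, and keeps numerator and denominator of \<open>(x)_k\<close> nonzero for every
  integer \<open>k\<close>.\<close>

definition q_generic :: "complex \<Rightarrow> complex \<Rightarrow> bool" where
  "q_generic q x \<longleftrightarrow> (\<forall>k::int. x * q powi k \<noteq> 1)"

lemma q_generic_shift: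
  assumes "q \<noteq> 0" "q_generic q x"
  shows "q_generic q (x * q powi m)"
  using assms by (auto simp: q_generic_def mult.assoc simp flip: power_int_add)

lemma q_generic_shift1: "q \<noteq> 0 \<Longrightarrow> q_generic q x \<Longrightarrow> q_generic q (x * q)"
  using q_generic_shift[of q x 1] by simp

lemma q_generic_nat: "q_generic q x \<Longrightarrow> x * q ^ k \<noteq> 1"
  unfolding q_generic_def by (metis power_int_of_nat)

lemma q_generic_int: "q_generic q x \<Longrightarrow> 1 - x * q powi k \<noteq> 0"
  unfolding q_generic_def by simp

lemma qpoch_inf_generic_nonzero:
  "norm q < 1 \<Longrightarrow> q_generic q x \<Longrightarrow> qpoch_inf q x \<noteq> 0"
  by (intro qpoch_inf_nonzero q_generic_nat)

lemma qpoch_generic_nonzero: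
  assumes "q \<noteq> 0" "norm q < 1" "q_generic q x"
  shows "qpoch q x k \<noteq> 0"
  using assms by (simp add: qpoch_def qpoch_inf_generic_nonzero q_generic_shift)

lemma qpoch_add:
  assumes "q \<noteq> 0" "norm q < 1" "q_generic q x"
  shows "qpoch q x (k + l) = qpoch q x k * qpoch q (x * q powi k) l"
  using assms qpoch_inf_generic_nonzero[OF assms(2) q_generic_shift[OF assms(1,3), of k]]
  by (simp add: qpoch_def power_int_add mult_ac)

lemma qpoch_add_nat:
  assumes "q \<noteq> 0" "norm q < 1" "q_generic q x"
  shows "qpoch q x (m + int k) = qpoch q x m * qfac q (x * q powi m) k"
  using qpoch_add[OF assms, of m "int k"] qpoch_nat[OF assms(2) q_generic_nat, of "x * q powi m"]
    q_generic_shift[OF assms(1,3), of m] by simp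

lemma qbinom_eq:
  assumes "q \<noteq> 0" "norm q < 1"
  shows "qbinom q N (int i) = qfac q q N * inv_qfac q (int i) * inv_qfac q (int N - int i)"
proof (cases "i \<le> N")
  case True
  then show ?thesis
    by (simp add: qbinom_def qpoch_q[OF assms] inv_qfac_nat)
qed (simp add: qbinom_def inv_qfac_neg)

lemma bailey_term_eq:
  assumes "q \<noteq> 0" "norm q < 1"
  shows "bailey_term q c \<alpha> n j = \<alpha> j * inv_qfac q (n - j) / qpoch q (c * q) (n + j)"
  by (simp add: bailey_term_def qpoch_q[OF assms])

section \<open>The coefficient identities behind the two steps\<close>

text \<open>With \<open>n = m + M\<close> and \<open>j = m + k\<close>, factoring out the values at
  \<open>m\<close> leaves the q-Saalschuetz sum for \<open>R = \<rho> q^m\<close> and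
  \<open>S = \<sigma> q^m\<close>. Its lower parameter fits because
  \<open>b q^(2m+1) = R S X\<close>.\<close>

lemma bailey_lemma_coefficient:
  assumes q: "q \<noteq> 0" "norm q < 1"
    and gen: "q_generic q b" "q_generic q \<rho>" "q_generic q \<sigma>"
       "q_generic q (b * q / \<rho>)" "q_generic q (b * q / \<sigma>)"
    and nz: "\<rho> \<noteq> 0" "\<sigma> \<noteq> 0" "b \<noteq> 0"
    and X: "X = b * q / (\<rho> * \<sigma>)" "\<And>k. X * q ^ k \<noteq> 1"
    and mn: "m \<le> n"
  shows "(\<Sum>j\<in>{m..n}. qpoch q \<rho> j * qpoch q \<sigma> j * qpoch q X (n - j) * X powi j
            * inv_qfac q (n - j) * inv_qfac q (j - m) / qpoch q (b * q) (j + m))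
         = qpoch q (b * q / \<rho>) n * qpoch q (b * q / \<sigma>) n
            / (qpoch q (b * q / \<rho>) m * qpoch q (b * q / \<sigma>) m)
            * (qpoch q \<rho> m * qpoch q \<sigma> m * X powi m * inv_qfac q (n - m) / qpoch q (b * q) (n + m))"
proof -
  obtain M where M: "n = m + int M"
    using zle_iff_zadd[of m n] mn by auto
  define R S where "R = \<rho> * q powi m" and "S = \<sigma> * q powi m"
  have X0: "X \<noteq> 0" using X nz q by simp
  have c: "b * q * q powi (2 * m) = R * S * X"
    using nz q by (simp add: R_def S_def X power_int_add flip: mult_2)
      (simp add: power_int_add power_int_mult power2_eq_square field_simps)
  have SX: "b * q / \<rho> * q powi m = S * X" "b * q / \<sigma> * q powi m = R * X"
    using nz by (simp_all add: R_def S_def X)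
  have gbq: "q_generic q (b * q)" by (intro q_generic_shift1 q gen)
  have gc: "q_generic q (R * S * X)"
    unfolding c[symmetric] by (intro q_generic_shift q gbq)
  have bq: "qpoch q (b * q) (m + m + int k) = qpoch q (b * q) (2 * m) * qfac q (R * S * X) k" for k
    using qpoch_add_nat[OF q gbq, of "2 * m" k] by (simp add: c)
  have "(\<Sum>j\<in>{m..n}. qpoch q \<rho> j * qpoch q \<sigma> j * qpoch q X (n - j) * X powi j
            * inv_qfac q (n - j) * inv_qfac q (j - m) / qpoch q (b * q) (j + m))
      = (\<Sum>k\<le>M. qpoch q \<rho> m * qpoch q \<sigma> m * X powi m / qpoch q (b * q) (2 * m)
          * (qfac q R k * qfac q S k * qfac q X (M - k) * X ^ k
            / (qfac q q (M - k) * qfac q q k * qfac q (R * S * X) k)))"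
  proof (rule sum.reindex_bij_witness[of _ "\<lambda>k. m + int k" "\<lambda>j. nat (j - m)"])
    fix j assume "j \<in> {m..n}"
    then obtain k where k: "j = m + int k" "k \<le> M"
      using zle_iff_zadd[of m j] M by auto
    have e: "m + int M - (m + int k) = int (M - k)" "m + int k - m = int k" "m + int k + m = m + m + int k"
      "nat (int k) = k"
      using k by auto
    show "qpoch q \<rho> m * qpoch q \<sigma> m * X powi m / qpoch q (b * q) (2 * m)
          * (qfac q R (nat (j - m)) * qfac q S (nat (j - m)) * qfac q X (M - nat (j - m)) * X ^ nat (j - m)
            / (qfac q q (M - nat (j - m)) * qfac q q (nat (j - m)) * qfac q (R * S * X) (nat (j - m))))
         = qpoch q \<rho> j * qpoch q \<sigma> j * qpoch q X (n - j) * X powi j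
            * inv_qfac q (n - j) * inv_qfac q (j - m) / qpoch q (b * q) (j + m)"
      unfolding M k(1) e bq qpoch_add_nat[OF q gen(2)] qpoch_add_nat[OF q gen(3)] inv_qfac_nat
        qpoch_nat[OF q(2) X(2)] R_def[symmetric] S_def[symmetric]
      using X0 by (simp add: power_int_add mult_ac)
  qed (auto simp: M)
  also have "\<dots> = qpoch q \<rho> m * qpoch q \<sigma> m * X powi m / qpoch q (b * q) (2 * m)
     * (qfac q (S * X) M * qfac q (R * X) M / (qfac q q M * qfac q (R * S * X) M))"
    unfolding sum_distrib_left[symmetric]
    by (subst q_Saalschuetz[OF q(2)]) (use q_generic_nat[OF gc] in auto)
  also have "\<dots> = qpoch q (b * q / \<rho>) n * qpoch q (b * q / \<sigma>) n
            / (qpoch q (b * q / \<rho>) m * qpoch q (b * q / \<sigma>) m)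
            * (qpoch q \<rho> m * qpoch q \<sigma> m * X powi m * inv_qfac q (n - m) / qpoch q (b * q) (n + m))"
  proof -
    have e: "m + int M - m = int M" "m + int M + m = m + m + int M" by auto
    show ?thesis
      unfolding M e bq qpoch_add_nat[OF q gen(4)] qpoch_add_nat[OF q gen(5)] SX inv_qfac_nat
      using qpoch_generic_nonzero[OF q gen(4), of m] qpoch_generic_nonzero[OF q gen(5), of m]
      by (simp add: mult_ac)
  qed
  finally show ?thesis .
qed

text \<open>The coefficient of \<open>\<alpha> (m - j)\<close> in the entry at \<open>m\<close> of
  the base-changed sequence, that is, in \<open>\<alpha>' m\<close> stripped of the factor depending
  on \<open>\<rho>\<close> and \<open>\<sigma>\<close>.\<close>

definition base_change_coeff :: "complex \<Rightarrow> complex \<Rightarrow> nat \<Rightarrow> int \<Rightarrow> nat \<Rightarrow> complex" where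
  "base_change_coeff q a N m j =
     (1 - a * q powi (2 * m - int N)) * qpoch q (a * q powi (1 - int N)) (int N)
     * ((-1) ^ j * (a ^ j * q powi ((2 * m - int N) * int j - int (j * (j + 1) div 2))
           / qpoch q (a * q powi (2 * m - int N - int j)) (int N + 1))
        * qbinom q N (int j))"

text \<open>The entry \<open>\<alpha> r\<close> enters the base-changed sequence at the indices
  \<open>r + i\<close> with \<open>i \<le> N\<close>. Comparing its coefficients and putting
  \<open>j = r + M\<close>, \<open>B = b q^(2r)\<close> reduces the claim to the very-well-poised
  sum.\<close>

lemma base_change_coefficient:
  assumes q: "q \<noteq> 0" "norm q < 1" and a: "q_generic q a"
    and b: "b = a * q powi (- int N)" and rj: "r \<le> j"
  shows "inv_qfac q (j - r) / qpoch q (a * q) (j + r)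
         = (\<Sum>i\<le>N. base_change_coeff q a N (r + int i) i
              * (inv_qfac q (j - (r + int i)) / qpoch q (b * q) (j + (r + int i))))"
proof -
  obtain M where M: "j = r + int M"
    using zle_iff_zadd[of r j] rj by auto
  define B where "B = b * q powi (2 * r)"
  have ab: "a = b * q ^ N" using q by (simp add: b power_int_minus)
  have gb: "q_generic q b" unfolding b by (intro q_generic_shift q a)
  have gbq: "q_generic q (b * q)" by (intro q_generic_shift1 q gb)
  have gB: "q_generic q B" unfolding B_def by (intro q_generic_shift q gb)
  have Bq: "b * q * q powi (2 * r) = B * q" by (simp add: B_def mult_ac)
  have aq: "b * q * q powi int N = a * q" by (simp add: ab mult_ac)
  have bN: "a * q powi (1 - int N) = b * q"
    using q by (simp add: b power_int_diff power_int_minus field_simps)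
  have bq: "qpoch q (b * q) (r + r + int k) = qpoch q (b * q) (2 * r) * qfac q (B * q) k" for k
    using qpoch_add_nat[OF q gbq, of "2 * r" k] by (simp add: Bq)
  have nz: "qpoch q (b * q) k \<noteq> 0" "qfac q B l \<noteq> 0" "qfac q (B * q) l \<noteq> 0" "qfac q q l \<noteq> 0" for k l
    using qpoch_generic_nonzero[OF q gbq] q_generic_nat[OF gB] q_generic_nat[OF q_generic_shift1[OF q(1) gB]]
      qfac_nonzero[of l B q] qfac_nonzero[of l "B * q" q] qfac_q_nonzero[OF q(2)] by auto
  \<comment> \<open>Since \<open>b q^(N+1) = a q\<close>, both sides equal the factorial of
    \<open>b q\<close> with index \<open>2r + M + N\<close>, split in two ways.\<close>
  have "qpoch q (b * q) (int N) * qpoch q (a * q) (r + r + int M)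
      = qpoch q (b * q) (2 * r) * qfac q (B * q) (M + N)"
  proof -
    have "int N + (r + r + int M) = r + r + int (M + N)" by simp
    then show ?thesis
      using qpoch_add[OF q gbq, of "int N" "r + r + int M"] bq[of "M + N"] aq by metis
  qed
  then have lhs: "qpoch q (a * q) (r + r + int M)
      = qpoch q (b * q) (2 * r) * qfac q (B * q) (M + N) / qpoch q (b * q) (int N)"
    using nz by (simp add: field_simps)
  have coeff: "base_change_coeff q a N (r + int i) i
      = qpoch q (b * q) (int N) * qfac q q N * ((1 - B * q ^ (2 * i)) * qfac q B i * (- B) ^ i
            * q powi (2 * (int i)\<^sup>2 - int (i * (i + 1) div 2))
            * inv_qfac q (int i) * inv_qfac q (int N - int i)
            / qfac q B (N + 1 + i))" for i
  proof -
    have "a * q powi (2 * (r + int i) - int N) = b * q powi (2 * r + int (2 * i))"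
      using q by (simp add: b power_int_diff power_int_minus power_int_add distrib_left field_simps)
    then have 1: "a * q powi (2 * (r + int i) - int N) = B * q ^ (2 * i)"
      using q power_int_of_nat[of q "2 * i"] by (simp add: B_def power_int_add)
    have "a * q powi (2 * (r + int i) - int N - int i) = b * q powi (2 * r + int i)"
      using q by (simp add: b power_int_diff power_int_minus power_int_add distrib_left field_simps)
    then have 2: "a * q powi (2 * (r + int i) - int N - int i) = B * q ^ i"
      using q by (simp add: B_def power_int_add)
    \<comment> \<open>Writing \<open>a = b q^N\<close> cancels the linear exponent
      \<open>- N i\<close>, and \<open>q^(2 r i)\<close> is absorbed in \<open>B ^ i\<close>; what
      remains no longer depends on \<open>r\<close> or \<open>N\<close>.\<close>
    have "a ^ i * q powi ((2 * (r + int i) - int N) * int i - int (i * (i + 1) div 2))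
       = b ^ i * q powi (int N * int i + ((2 * (r + int i) - int N) * int i - int (i * (i + 1) div 2)))"
      using q by (simp add: ab power_int_add power_mult_distrib power_mult power_int_mult)
    also have "int N * int i + ((2 * (r + int i) - int N) * int i - int (i * (i + 1) div 2))
        = 2 * r * int i + (2 * (int i)\<^sup>2 - int (i * (i + 1) div 2))"
      by (simp add: algebra_simps power2_eq_square)
    also have "b ^ i * q powi \<dots> = B ^ i * q powi (2 * (int i)\<^sup>2 - int (i * (i + 1) div 2))"
    proof -
      have "q powi (2 * r * int i) = (q powi (2 * r)) ^ i" by (simp only: power_int_mult power_int_of_nat)
      then show ?thesis using q by (subst power_int_add) (auto simp: B_def power_mult_distrib)
    qed
    finally have 3: "a ^ i * q powi ((2 * (r + int i) - int N) * int i - int (i * (i + 1) div 2))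
       = B ^ i * q powi (2 * (int i)\<^sup>2 - int (i * (i + 1) div 2))" .
    have "qpoch q (B * q ^ i) (int (N + 1)) = qfac q (B * q ^ i) (N + 1)"
      by (intro qpoch_nat q q_generic_nat) (use q_generic_shift[OF q(1) gB, of "int i"] in simp)
    moreover have "qfac q B (N + 1 + i) = qfac q B i * qfac q (B * q ^ i) (N + 1)"
      using qfac_add[of q B i "N + 1"] by (simp add: add_ac)
    ultimately have 4: "1 / qpoch q (B * q ^ i) (int N + 1) = qfac q B i / qfac q B (N + 1 + i)"
      using nz by (simp add: add_ac)
    have 5: "x / qpoch q (B * q ^ i) (int N + 1) = x * (qfac q B i / qfac q B (N + 1 + i))" for x
      unfolding 4[symmetric] by simp
    show ?thesis
      unfolding base_change_coeff_def 1 2 3 5 bN qbinom_eq[OF q]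
      by (subst power_minus) (simp add: mult_ac)
  qed
  have "(\<Sum>i\<le>N. base_change_coeff q a N (r + int i) i
              * (inv_qfac q (j - (r + int i)) / qpoch q (b * q) (j + (r + int i))))
      = qpoch q (b * q) (int N) * qfac q q N / qpoch q (b * q) (2 * r)
        * (\<Sum>i\<le>N. (1 - B * q ^ (2 * i)) * qfac q B i * (- B) ^ i
            * q powi (2 * (int i)\<^sup>2 - int (i * (i + 1) div 2))
            * inv_qfac q (int i) * inv_qfac q (int N - int i) * inv_qfac q (int M - int i)
            / (qfac q B (N + 1 + i) * qfac q (B * q) (M + i)))"
    unfolding sum_distrib_left
  proof (rule sum.cong[OF refl])
    fix i
    have e: "r + int M - (r + int i) = int M - int i" "r + int M + (r + int i) = r + r + int (M + i)" by auto
    show "base_change_coeff q a N (r + int i) i * (inv_qfac q (j - (r + int i)) / qpoch q (b * q) (j + (r + int i)))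
       = qpoch q (b * q) (int N) * qfac q q N / qpoch q (b * q) (2 * r) *
        ((1 - B * q ^ (2 * i)) * qfac q B i * (- B) ^ i
            * q powi (2 * (int i)\<^sup>2 - int (i * (i + 1) div 2))
            * inv_qfac q (int i) * inv_qfac q (int N - int i) * inv_qfac q (int M - int i)
            / (qfac q B (N + 1 + i) * qfac q (B * q) (M + i)))"
      unfolding coeff M e bq by (simp add: mult_ac)
  qed
  also have "\<dots> = qpoch q (b * q) (int N) * qfac q q N / qpoch q (b * q) (2 * r)
     * (1 / (qfac q q M * qfac q q N * qfac q (B * q) (M + N)))"
    by (subst very_well_poised_sum[OF q q_generic_nat[OF gB]]) simp
  also have "\<dots> = inv_qfac q (j - r) / qpoch q (a * q) (j + r)"
  proof -
    have e: "r + int M - r = int M" "r + int M + r = r + r + int M" by auto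
    show ?thesis unfolding M e lhs inv_qfac_nat using nz by (simp add: field_simps)
  qed
  finally show ?thesis by simp
qed

subsection \<open>Convergence and interchange of summations\<close>

text \<open>The ratio test makes \<open>v\<close> summable, hence a null sequence, hence bounded.
  The product form of the recursion allows \<open>v\<close> to have zeros.\<close>

lemma bounded_if_ratio_tendsto_0:
  fixes v s :: "nat \<Rightarrow> complex"
  assumes rec: "\<And>k. v (Suc k) = v k * s k" and s: "s \<longlonglongrightarrow> 0"
  obtains C where "\<And>k. norm (v k) \<le> C"
proof -
  have "eventually (\<lambda>k. norm (s k) < 1 / 2) sequentially"
    using order_tendstoD(2)[OF tendsto_norm_zero[OF s], of "1 / 2"] by simp
  then obtain K where K: "\<And>k. k \<ge> K \<Longrightarrow> norm (s k) < 1 / 2"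
    by (auto simp: eventually_sequentially)
  have "norm (v (Suc k)) \<le> 1 / 2 * norm (v k)" if "k \<ge> K" for k
    using mult_right_mono[OF less_imp_le[OF K[OF that]], of "norm (v k)"]
    by (simp add: rec norm_mult mult.commute)
  then have "summable v" by (rule summable_ratio_test[of "1 / 2", rotated]) auto
  then have "Bseq v" using convergent_imp_Bseq convergent_def summable_LIMSEQ_zero by blast
  then show ?thesis using that by (auto elim!: BseqE)
qed

text \<open>Passes from unconditional summation, in which the rearrangements are made, to the
  ordered series in the definition of a Bailey pair.\<close>

lemma has_sum_atMost_int_imp_sums:
  fixes f :: "int \<Rightarrow> complex"
  assumes "(f has_sum s) {..n}"
  shows "(\<lambda>k. f (n - int k)) sums s"
proof (rule has_sum_imp_sums)
  have "((\<lambda>k. f (n - int k)) has_sum s) UNIV \<longleftrightarrow> (f has_sum s) {..n}"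
    by (rule has_sum_reindex_bij_witness[where j = "\<lambda>k. n - int k" and i = "\<lambda>j. nat (n - j)"]) auto
  then show "((\<lambda>k. f (n - int k)) has_sum s) UNIV" using assms by simp
qed

lemma has_sum_finite_sum:
  fixes f :: "'a \<Rightarrow> 'b \<Rightarrow> complex"
  assumes "finite I" "\<And>i. i \<in> I \<Longrightarrow> (f i has_sum s i) A"
  shows "((\<lambda>x. \<Sum>i\<in>I. f i x) has_sum (\<Sum>i\<in>I. s i)) A"
  using assms by (induction I rule: finite_induct) (auto intro!: has_sum_add)

section \<open>Coefficients of the transformed pair and their size\<close>

locale bailey_step =
  fixes q a \<rho> \<sigma> b X :: complex and N :: nat
  assumes q: "q \<noteq> 0" "norm q < 1"
    and nz: "a \<noteq> 0" "\<rho> \<noteq> 0" "\<sigma> \<noteq> 0"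
    and gen_a: "q_generic q a"
    and gen_rho: "q_generic q \<rho>" and gen_sigma: "q_generic q \<sigma>"
    and gen_b_rho: "q_generic q (b * q / \<rho>)" and gen_b_sigma: "q_generic q (b * q / \<sigma>)"
    and b: "b = a * q powi (- int N)"
    and X: "X = b * q / (\<rho> * \<sigma>)" and gen_X: "\<And>k. X * q ^ k \<noteq> 1"
begin

text \<open>The coefficient of \<open>\<beta> j\<close> in \<open>\<beta>' n\<close>.\<close>

definition kern :: "int \<Rightarrow> int \<Rightarrow> complex" where
  "kern n j = qpoch q \<rho> j * qpoch q \<sigma> j * qpoch q X (n - j) * X powi j
     / (qpoch q q (n - j) * (qpoch q (b * q / \<rho>) n * qpoch q (b * q / \<sigma>) n))"

text \<open>The factor by which the Bailey lemma relative to \<open>b\<close> multiplies the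
  base-changed sequence.\<close>

definition weight :: "int \<Rightarrow> complex" where
  "weight m = qpoch q \<rho> m * qpoch q \<sigma> m * X powi m
     / (qpoch q (b * q / \<rho>) m * qpoch q (b * q / \<sigma>) m)"

text \<open>The coefficient of \<open>\<alpha> (m - i)\<close> in the term of index \<open>m\<close>
  of the series relative to \<open>b\<close> that is to give \<open>\<beta>' n\<close>.\<close>

definition new_coeff :: "int \<Rightarrow> int \<Rightarrow> nat \<Rightarrow> complex" where
  "new_coeff n m i = base_change_coeff q a N m i * weight m
     * (inv_qfac q (n - m) / qpoch q (b * q) (n + m))"

lemma gen_b: "q_generic q b"
  unfolding b by (intro q_generic_shift q gen_a)

lemma b_nonzero: "b \<noteq> 0" and X_nonzero: "X \<noteq> 0"
  using nz q by (auto simp: X b)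

lemma kern_eq:
  "kern n j = qpoch q \<rho> j * qpoch q \<sigma> j * qpoch q X (n - j) * X powi j * inv_qfac q (n - j)
     / (qpoch q (b * q / \<rho>) n * qpoch q (b * q / \<sigma>) n)"
  by (simp add: kern_def qpoch_q[OF q])

lemma kern_nonzero:
  assumes "j \<le> n"
  shows "kern n j \<noteq> 0"
proof -
  obtain k where k: "n - j = int k" using zero_le_imp_eq_int[of "n - j"] assms by auto
  have "qfac q X k \<noteq> 0" using gen_X by (intro qfac_nonzero)
  then show ?thesis
    unfolding kern_eq k
    using qpoch_nat[OF q(2) gen_X, of k] qfac_q_nonzero[OF q(2), of k] X_nonzero
    by (simp add: inv_qfac_nat qpoch_generic_nonzero[OF q] gen_rho gen_sigma gen_b_rho gen_b_sigma)
qed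

text \<open>Both steps at the level of coefficients: expand by the base change, exchange the two
  finite sums, and evaluate each inner sum by the Bailey lemma.\<close>

lemma kern_sum:
  assumes rn: "r \<le> n"
  shows "(\<Sum>j\<in>{r..n}. kern n j * (inv_qfac q (j - r) / qpoch q (a * q) (j + r)))
         = (\<Sum>i\<le>N. new_coeff n (r + int i) i)"
proof -
  \<comment> \<open>Terms with \<open>j < m\<close> vanish, so the lower limit may be
    \<open>r\<close>; for \<open>m > n\<close> both sides are zero.\<close>
  have inner: "(\<Sum>j\<in>{r..n}. kern n j * (inv_qfac q (j - m) / qpoch q (b * q) (j + m)))
      = weight m * (inv_qfac q (n - m) / qpoch q (b * q) (n + m))" if "r \<le> m" for m
  proof (cases "m \<le> n")
    case True
    define D where "D = qpoch q (b * q / \<rho>) n * qpoch q (b * q / \<sigma>) n"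
    have D: "D \<noteq> 0"
      by (simp add: D_def qpoch_generic_nonzero[OF q] gen_b_rho gen_b_sigma)
    have "(\<Sum>j\<in>{r..n}. kern n j * (inv_qfac q (j - m) / qpoch q (b * q) (j + m)))
       = (\<Sum>j\<in>{m..n}. kern n j * (inv_qfac q (j - m) / qpoch q (b * q) (j + m)))"
      using \<open>r \<le> m\<close> by (intro sum.mono_neutral_right) (auto simp: inv_qfac_neg)
    also have "\<dots> = (\<Sum>j\<in>{m..n}. qpoch q \<rho> j * qpoch q \<sigma> j * qpoch q X (n - j) * X powi j
            * inv_qfac q (n - j) * inv_qfac q (j - m) / qpoch q (b * q) (j + m)) / D"
      unfolding sum_divide_distrib by (intro sum.cong) (simp_all add: kern_eq D_def mult_ac)
    also have "\<dots> = weight m * (inv_qfac q (n - m) / qpoch q (b * q) (n + m))"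
      by (subst bailey_lemma_coefficient[OF q gen_b gen_rho gen_sigma gen_b_rho gen_b_sigma nz(2,3) b_nonzero X gen_X True])
        (use D in \<open>simp add: weight_def D_def\<close>)
    finally show ?thesis .
  qed (use that in \<open>auto simp: inv_qfac_neg intro!: sum.neutral\<close>)
  have "(\<Sum>j\<in>{r..n}. kern n j * (inv_qfac q (j - r) / qpoch q (a * q) (j + r)))
     = (\<Sum>j\<in>{r..n}. \<Sum>i\<le>N. base_change_coeff q a N (r + int i) i
          * (kern n j * (inv_qfac q (j - (r + int i)) / qpoch q (b * q) (j + (r + int i)))))"
    by (intro sum.cong) (simp_all add: base_change_coefficient[OF q gen_a b] sum_distrib_left mult_ac)
  also have "\<dots> = (\<Sum>i\<le>N. base_change_coeff q a N (r + int i) i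
          * (\<Sum>j\<in>{r..n}. kern n j * (inv_qfac q (j - (r + int i)) / qpoch q (b * q) (j + (r + int i)))))"
    by (subst sum.swap) (simp add: sum_distrib_left)
  also have "\<dots> = (\<Sum>i\<le>N. new_coeff n (r + int i) i)"
    by (intro sum.cong refl) (subst inner, simp_all add: new_coeff_def)
  finally show ?thesis .
qed

text \<open>Up to the constant \<open>(q)_i\<close>, the bound is the coefficient of
  \<open>\<alpha> (m - i)\<close> at the place \<open>(m, m - i)\<close> of the double series. The
  quotient of the two coefficients is \<open>K * v m\<close>, with \<open>K\<close> independent of
  \<open>m\<close> and \<open>v\<close> bounded as \<open>m\<close> decreases.\<close>

lemma new_coeff_bound:
  obtains C where "\<And>m. m \<le> n \<Longrightarrow>
     norm (new_coeff n m i) \<le> C * norm (kern n m / qpoch q (a * q) (2 * m - int i))"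
proof -
  \<comment> \<open>Infinite products shifted by powers of \<open>q\<close> make
    \<open>v (m - 1) / v m\<close> a rational function of \<open>q^m\<close> and
    \<open>q^(n-m)\<close>.\<close>
  define v where "v m = (1 - b * q powi (2 * m)) * q powi (2 * m * int i)
     * qpoch_inf q (b * q / \<rho> * q powi m) * qpoch_inf q (b * q / \<sigma> * q powi m)
     * qpoch_inf q (X * q powi (n - m)) * qpoch_inf q (b * q * q powi (n + m))
     / qpoch_inf q (b * q powi (2 * m - int i))" for m
  define K where "K = qpoch q (b * q) (int N)
     * ((-1) ^ i * a ^ i * q powi (- int N * int i - int (i * (i + 1) div 2)) * qbinom q N (int i))
     * (qpoch q (b * q / \<rho>) n * qpoch q (b * q / \<sigma>) n) * qpoch_inf q (a * q)
     / (qpoch_inf q (b * q / \<rho>) * qpoch_inf q (b * q / \<sigma>) * qpoch_inf q X * qpoch_inf q (b * q))"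
  have coeff: "new_coeff n m i = kern n m / qpoch q (a * q) (2 * m - int i) * (K * v m)" if "m \<le> n" for m
  proof -
    define r\<^sub>m s\<^sub>m X\<^sub>m B\<^sub>m A\<^sub>m Z\<^sub>m
      where "r\<^sub>m = qpoch_inf q (b * q / \<rho> * q powi m)" and "s\<^sub>m = qpoch_inf q (b * q / \<sigma> * q powi m)"
        and "X\<^sub>m = qpoch_inf q (X * q powi (n - m))" and "B\<^sub>m = qpoch_inf q (b * q * q powi (n + m))"
        and "A\<^sub>m = qpoch_inf q (a * q * q powi (2 * m - int i))"
        and "Z\<^sub>m = qpoch_inf q (b * q powi (2 * m - int i))"
    define r\<^sub>0 s\<^sub>0 X\<^sub>0 B\<^sub>0 A\<^sub>0
      where "r\<^sub>0 = qpoch_inf q (b * q / \<rho>)" and "s\<^sub>0 = qpoch_inf q (b * q / \<sigma>)"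
        and "X\<^sub>0 = qpoch_inf q X" and "B\<^sub>0 = qpoch_inf q (b * q)" and "A\<^sub>0 = qpoch_inf q (a * q)"
    define D where "D = qpoch q (b * q / \<rho>) n * qpoch q (b * q / \<sigma>) n"
    note defs = r\<^sub>m_def s\<^sub>m_def X\<^sub>m_def B\<^sub>m_def A\<^sub>m_def Z\<^sub>m_def r\<^sub>0_def s\<^sub>0_def X\<^sub>0_def B\<^sub>0_def A\<^sub>0_def D_def
    have gbq: "q_generic q (b * q)" and gaq: "q_generic q (a * q)"
      by (intro q_generic_shift1 q gen_a gen_b)+
    have Xm: "X\<^sub>m \<noteq> 0" "X\<^sub>0 \<noteq> 0"
    proof -
      \<comment> \<open>\<open>gen_X\<close> covers only nonnegative exponents, so
        \<open>m \<le> n\<close> enters here.\<close>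
      have "X * q powi (n - m) * q ^ k \<noteq> 1" for k
      proof -
        have "q powi (n - m) * q ^ k = q ^ (nat (n - m) + k)"
          using that by (simp add: power_add power_int_def)
        then show ?thesis using gen_X[of "nat (n - m) + k"] by (simp add: mult.assoc)
      qed
      then show "X\<^sub>m \<noteq> 0" "X\<^sub>0 \<noteq> 0"
        unfolding defs by (simp_all add: qpoch_inf_nonzero[OF q(2)] gen_X)
    qed
    have nonzero: "r\<^sub>m \<noteq> 0" "s\<^sub>m \<noteq> 0" "B\<^sub>m \<noteq> 0" "A\<^sub>m \<noteq> 0" "Z\<^sub>m \<noteq> 0" "r\<^sub>0 \<noteq> 0" "s\<^sub>0 \<noteq> 0" "B\<^sub>0 \<noteq> 0" "A\<^sub>0 \<noteq> 0" "D \<noteq> 0"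
      unfolding defs
      using gbq gaq gen_b_rho gen_b_sigma gen_b q
        qpoch_inf_generic_nonzero[OF q(2) q_generic_shift[OF q(1) gen_b_rho, of m]]
        qpoch_inf_generic_nonzero[OF q(2) q_generic_shift[OF q(1) gen_b_sigma, of m]]
      by (simp_all add: qpoch_inf_generic_nonzero qpoch_generic_nonzero q_generic_shift)
    \<comment> \<open>The quotient of infinite products starts at \<open>b q^(2m-i)\<close> and ends
      at \<open>a q^(2m-i+1)\<close>, because \<open>b q^(N+1) = a q\<close>.\<close>
    have Z: "qpoch q (a * q powi (2 * m - int N - int i)) (int N + 1) = Z\<^sub>m / A\<^sub>m"
    proof -
      have "a * q powi (2 * m - int N - int i) = b * q powi (2 * m - int i)"
        using q power_int_add[of q "- int N" "2 * m - int i"] by (simp add: b algebra_simps)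
      moreover have "b * q powi (2 * m - int i) * q powi (int N + 1) = a * q * q powi (2 * m - int i)"
        using q by (simp add: b power_int_add power_int_minus field_simps)
      ultimately show ?thesis by (simp only: qpoch_def defs)
    qed
    have bN: "a * q powi (1 - int N) = b * q" and bm: "a * q powi (2 * m - int N) = b * q powi (2 * m)"
      using q by (simp_all add: b power_int_diff power_int_minus field_simps)
    have e: "q powi ((2 * m - int N) * int i - int (i * (i + 1) div 2))
       = q powi (2 * m * int i) * q powi (- int N * int i - int (i * (i + 1) div 2))"
      using q by (subst power_int_add[symmetric]) (auto simp: algebra_simps)
    have ws: "qpoch q (b * q / \<rho>) m = r\<^sub>0 / r\<^sub>m" "qpoch q (b * q / \<sigma>) m = s\<^sub>0 / s\<^sub>m"
      "qpoch q X (n - m) = X\<^sub>0 / X\<^sub>m" "qpoch q (b * q) (n + m) = B\<^sub>0 / B\<^sub>m"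
      "qpoch q (a * q) (2 * m - int i) = A\<^sub>0 / A\<^sub>m"
      by (simp_all add: qpoch_def defs)
    have v: "v m = (1 - b * q powi (2 * m)) * q powi (2 * m * int i) * r\<^sub>m * s\<^sub>m * X\<^sub>m * B\<^sub>m / Z\<^sub>m"
      by (simp add: v_def defs)
    have K: "K = qpoch q (b * q) (int N)
       * ((-1) ^ i * a ^ i * q powi (- int N * int i - int (i * (i + 1) div 2)) * qbinom q N (int i))
       * D * A\<^sub>0 / (r\<^sub>0 * s\<^sub>0 * X\<^sub>0 * B\<^sub>0)"
      by (simp add: K_def defs)
    show ?thesis
      unfolding new_coeff_def base_change_coeff_def weight_def kern_eq D_def[symmetric] Z bN bm e ws v K
      using nonzero Xm by (simp add: mult_ac)
  qed
  have "\<exists>C. \<forall>k. norm (v (n - int k)) \<le> C"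
  proof -
    define Q where "Q = q powi n"
    \<comment> \<open>\<open>s\<close> is the ratio \<open>v (m - 1) / v m\<close> for
      \<open>m = n - k\<close>, written in \<open>y = q^k\<close> after substituting
      \<open>q^m = Q / y\<close>. Clearing the powers of \<open>y\<close> leaves one net factor
      \<open>y\<close>. The denominator is nonzero at 0, so \<open>s\<close> is continuous there
      with value 0.\<close>
    define s where "s y = (y ^ 2 - b * Q ^ 2 / q ^ 2) / (y ^ 2 - b * Q ^ 2) / q ^ (2 * i) * y
       * (y - b * Q / \<rho>) * (y - b * Q / \<sigma>) * (y - b * Q ^ 2)
       / ((1 - X * y) * (y ^ 2 - b * Q ^ 2 / q ^ (i + 2)) * (y ^ 2 - b * Q ^ 2 / q ^ (i + 1)))" for y
    have Q: "Q \<noteq> 0" using q by (simp add: Q_def)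
    have "s \<midarrow>0\<rightarrow> s 0"
      unfolding s_def using Q b_nonzero q by (intro tendsto_intros) auto
    moreover have "filterlim (\<lambda>k. q ^ k) (at 0) sequentially"
      using q by (auto simp: filterlim_at LIMSEQ_power_zero)
    ultimately have "(\<lambda>k. s (q ^ k)) \<longlonglongrightarrow> s 0" by (rule filterlim_compose)
    then have lim: "(\<lambda>k. s (q ^ k)) \<longlonglongrightarrow> 0" by (simp add: s_def)
    have rec: "v (n - int (Suc k)) = v (n - int k) * s (q ^ k)" for k
    proof -
      define m where "m = n - int k"
      define x y where "x = q powi m" and "y = q ^ k"
      have y: "y \<noteq> 0" using q by (simp add: y_def)
      have x: "x = Q / y" using q by (simp add: x_def y_def Q_def m_def power_int_diff)
      have m': "n - int (Suc k) = m - 1" by (simp add: m_def)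
      have p: "q powi (m - 1) = x / q" "q powi (2 * m) = x ^ 2" "q powi (2 * (m - 1)) = x ^ 2 / q ^ 2"
        "q powi (2 * (m - 1) * int i) = q powi (2 * m * int i) / q ^ (2 * i)"
        "q powi (n - m) = y" "q powi (n - (m - 1)) = y * q"
        "q powi (n + m) = Q * x" "q powi (n + (m - 1)) = Q * x / q"
        "q powi (2 * m - int i) = x ^ 2 / q ^ i" "q powi (2 * (m - 1) - int i) = x ^ 2 / q ^ (i + 2)"
      proof -
        have d: "q powi (l - int t) = q powi l / q ^ t" for l t
          using q by (simp add: power_int_diff)
        have two: "q powi (2 * m) = x ^ 2"
          unfolding x_def mult_2 power2_eq_square by (rule power_int_add) (use q in simp)
        have ints: "2 * (m - 1) = 2 * m - int 2" "2 * (m - 1) * int i = 2 * m * int i - int (2 * i)"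
          "m - 1 = m - int 1" "n - (m - 1) = int (Suc k)" "n - m = int k" "n + (m - 1) = n + m - int 1"
          "2 * (m - 1) - int i = 2 * m - int (i + 2)"
          by (simp_all add: m_def algebra_simps)
        show "q powi (2 * m) = x ^ 2" by (rule two)
        show "q powi (m - 1) = x / q" unfolding ints(3) d by (simp add: x_def)
        show "q powi (2 * (m - 1)) = x ^ 2 / q ^ 2" unfolding ints(1) d two ..
        show "q powi (2 * (m - 1) * int i) = q powi (2 * m * int i) / q ^ (2 * i)" unfolding ints(2) d ..
        show "q powi (n - m) = y" "q powi (n - (m - 1)) = y * q"
          unfolding ints(4,5) power_int_of_nat y_def by simp_all
        show *: "q powi (n + m) = Q * x" using q by (simp add: Q_def x_def power_int_add)
        show "q powi (n + (m - 1)) = Q * x / q" unfolding ints(6) d * by simp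
        show "q powi (2 * m - int i) = x ^ 2 / q ^ i" unfolding d two ..
        show "q powi (2 * (m - 1) - int i) = x ^ 2 / q ^ (i + 2)" unfolding ints(7) d two ..
      qed
      have r: "qpoch_inf q (b * q / \<rho> * (x / q)) = (1 - b * x / \<rho>) * qpoch_inf q (b * q / \<rho> * x)"
        using qpoch_inf_rec[OF q(2), of "b * x / \<rho>"] q by (simp add: mult_ac)
      have s: "qpoch_inf q (b * q / \<sigma> * (x / q)) = (1 - b * x / \<sigma>) * qpoch_inf q (b * q / \<sigma> * x)"
        using qpoch_inf_rec[OF q(2), of "b * x / \<sigma>"] q by (simp add: mult_ac)
      have Xy: "1 - X * y \<noteq> 0" using gen_X[of k] by (simp add: y_def)
      have Xr: "qpoch_inf q (X * (y * q)) = qpoch_inf q (X * y) / (1 - X * y)"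
        using qpoch_inf_rec[OF q(2), of "X * y"] Xy by (simp add: mult_ac)
      have Br: "qpoch_inf q (b * q * (Q * x / q)) = (1 - b * Q * x) * qpoch_inf q (b * q * (Q * x))"
        using qpoch_inf_rec[OF q(2), of "b * Q * x"] q by (simp add: mult_ac)
      have Zr: "qpoch_inf q (b * (x ^ 2 / q ^ (i + 2)))
         = (1 - b * x ^ 2 / q ^ (i + 2)) * (1 - b * x ^ 2 / q ^ (i + 1)) * qpoch_inf q (b * (x ^ 2 / q ^ i))"
        using qpoch_inf_rec[OF q(2), of "b * x ^ 2 / q ^ (i + 2)"] qpoch_inf_rec[OF q(2), of "b * x ^ 2 / q ^ (i + 1)"] q
        by (simp add: mult_ac)
      have b1: "1 - b * x ^ 2 \<noteq> 0" using q_generic_int[OF gen_b, of "2 * m"] p(2) by simp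
      have "v (m - 1) = v m * ((1 - b * x ^ 2 / q ^ 2) / (1 - b * x ^ 2) / q ^ (2 * i)
         * (1 - b * x / \<rho>) * (1 - b * x / \<sigma>) * (1 - b * Q * x)
         / ((1 - X * y) * (1 - b * x ^ 2 / q ^ (i + 2)) * (1 - b * x ^ 2 / q ^ (i + 1))))"
        unfolding v_def p x_def[symmetric] r s Xr Br Zr using b1 by (simp add: mult_ac)
      also have "(1 - b * x ^ 2 / q ^ 2) / (1 - b * x ^ 2) / q ^ (2 * i)
         * (1 - b * x / \<rho>) * (1 - b * x / \<sigma>) * (1 - b * Q * x)
         / ((1 - X * y) * (1 - b * x ^ 2 / q ^ (i + 2)) * (1 - b * x ^ 2 / q ^ (i + 1))) = s y"
      proof -
        have sq: "1 - c * x ^ 2 = (y ^ 2 - c * Q ^ 2) / y ^ 2" and lin: "1 - c * x = (y - c * Q) / y" for c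
          using y by (simp_all add: x field_simps)
        have q2: "1 - b * x ^ 2 / t = (y ^ 2 - b * Q ^ 2 / t) / y ^ 2" 
          "1 - b * x / t = (y - b * Q / t) / y" for t
          using sq[of "b / t"] lin[of "b / t"] by simp_all
        have lin2: "1 - b * Q * x = (y - b * Q ^ 2) / y"
          using lin[of "b * Q"] by (simp add: power2_eq_square mult_ac)
        have y2: "A1 / y\<^sup>2 / (A2 / y\<^sup>2) / t * (A3 / y) * (A4 / y) * (A5 / y) / (A6 * (A7 / y\<^sup>2) * (A8 / y\<^sup>2))
            = A1 / A2 / t * y * A3 * A4 * A5 / (A6 * A7 * A8)" for A1 A2 A3 A4 A5 A6 A7 A8 t
          using y by (simp add: field_simps power2_eq_square)
        show ?thesis unfolding s_def q2 sq lin2 by (rule y2)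
      qed
      finally show ?thesis unfolding m' by (simp add: m_def y_def)
    qed
    show ?thesis using bounded_if_ratio_tendsto_0[OF rec lim] by metis
  qed
  then obtain C where C: "\<And>k. norm (v (n - int k)) \<le> C" by auto
  show ?thesis
  proof (rule that)
    fix m assume m: "m \<le> n"
    have "norm (v m) \<le> C" using C[of "nat (n - m)"] m by simp
    then have "norm (K * v m) \<le> norm K * C" by (simp add: norm_mult mult_left_mono)
    then have "norm (kern n m / qpoch q (a * q) (2 * m - int i)) * norm (K * v m)
       \<le> norm (kern n m / qpoch q (a * q) (2 * m - int i)) * (norm K * C)"
      by (intro mult_left_mono) auto
    then show "norm (new_coeff n m i) \<le> norm K * C * norm (kern n m / qpoch q (a * q) (2 * m - int i))"
      unfolding coeff[OF m] norm_mult[of "kern n m / _"] by (simp add: mult.commute)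
  qed
qed

section \<open>Rearranging the double series for a fixed \<open>n\<close>\<close>

context
  fixes \<alpha> \<beta> :: "int \<Rightarrow> complex" and n :: int
  assumes pair: "bilateral_bailey_pair q a \<alpha> \<beta>"
    and abs_conv: "(\<lambda>(j, r). norm (kern n j * bailey_term q a \<alpha> j r)) summable_on {(j, r). r \<le> j \<and> j \<le> n}"
begin

text \<open>The places \<open>(m, m - i)\<close> form a subfamily of the absolutely summable double
  series, and \<open>new_coeff_bound\<close> compares the shifted series with it.\<close>

lemma new_coeff_summable:
  "(\<lambda>m. \<alpha> (m - int i) * new_coeff n m i) summable_on {..n}"
proof -
  obtain C where C: "\<And>m. m \<le> n \<Longrightarrow>
     norm (new_coeff n m i) \<le> C * norm (kern n m / qpoch q (a * q) (2 * m - int i))"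
    using new_coeff_bound by blast
  have sub: "(\<lambda>m. (m, m - int i)) ` {..n} \<subseteq> {(j, r). r \<le> j \<and> j \<le> n}" by auto
  have "(\<lambda>(j, r). norm (kern n j * bailey_term q a \<alpha> j r)) summable_on (\<lambda>m. (m, m - int i)) ` {..n}"
    using summable_on_subset_banach[OF abs_conv sub] .
  then have "((\<lambda>(j, r). norm (kern n j * bailey_term q a \<alpha> j r)) \<circ> (\<lambda>m. (m, m - int i))) summable_on {..n}"
    by (subst (asm) summable_on_reindex) (auto simp: inj_on_def)
  then have S: "(\<lambda>m. norm (kern n m * bailey_term q a \<alpha> m (m - int i))) summable_on {..n}"
    by (simp add: o_def)
  have "(\<lambda>m. norm (\<alpha> (m - int i) * new_coeff n m i)) summable_on {..n}"
  proof (rule Infinite_Sum.abs_summable_on_comparison_test')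
    show "(\<lambda>m. C * norm (qfac q q i) * norm (kern n m * bailey_term q a \<alpha> m (m - int i))) summable_on {..n}"
      using S by (intro summable_on_cmult_right)
    fix m assume "m \<in> {..n}"
    then have "norm (\<alpha> (m - int i)) * norm (new_coeff n m i)
       \<le> norm (\<alpha> (m - int i)) * (C * norm (kern n m / qpoch q (a * q) (2 * m - int i)))"
      using C by (intro mult_left_mono) auto
    also have "\<dots> = C * norm (qfac q q i) * norm (kern n m * bailey_term q a \<alpha> m (m - int i))"
    proof -
      have "m + (m - int i) = 2 * m - int i" by simp
      then show ?thesis
        using qfac_q_nonzero[OF q(2), of i]
        by (simp add: bailey_term_eq[OF q] inv_qfac_nat norm_mult norm_divide)
    qed
    finally show "norm (\<alpha> (m - int i) * new_coeff n m i)
       \<le> C * norm (qfac q q i) * norm (kern n m * bailey_term q a \<alpha> m (m - int i))"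
      by (simp add: norm_mult)
  qed
  then show ?thesis by (rule abs_summable_summable)
qed

text \<open>The pair gives \<open>\<beta> j\<close> only as a series in a fixed order. Row
  \<open>j\<close> of the double series is absolutely summable, so its unconditional sum is also the
  ordered limit, and limits are unique.\<close>

lemma kern_beta_eq:
  assumes "j \<le> n"
  shows "kern n j * \<beta> j = (\<Sum>\<^sub>\<infinity>r\<in>{..j}. kern n j * bailey_term q a \<alpha> j r)"
proof -
  have sub: "Pair j ` {..j} \<subseteq> {(j, r). r \<le> j \<and> j \<le> n}" using assms by auto
  have "(\<lambda>(j, r). norm (kern n j * bailey_term q a \<alpha> j r)) summable_on Pair j ` {..j}"
    using summable_on_subset_banach[OF abs_conv sub] .
  then have "((\<lambda>(j, r). norm (kern n j * bailey_term q a \<alpha> j r)) \<circ> Pair j) summable_on {..j}"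
    by (subst (asm) summable_on_reindex) (auto simp: inj_on_def)
  then have "(\<lambda>r. norm (kern n j * bailey_term q a \<alpha> j r)) summable_on {..j}"
    by (simp add: o_def)
  then have S: "(\<lambda>r. kern n j * bailey_term q a \<alpha> j r) summable_on {..j}"
    by (rule abs_summable_summable)
  then have "(\<lambda>k. kern n j * bailey_term q a \<alpha> j (j - int k))
      sums (\<Sum>\<^sub>\<infinity>r\<in>{..j}. kern n j * bailey_term q a \<alpha> j r)"
    by (intro has_sum_atMost_int_imp_sums has_sum_infsum)
  moreover have "(\<lambda>k. kern n j * bailey_term q a \<alpha> j (j - int k)) sums (kern n j * \<beta> j)"
    using pair unfolding bilateral_bailey_pair_def by (intro sums_mult) auto
  ultimately show ?thesis by (rule sums_unique2[symmetric])
qed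

text \<open>Summing the double series by rows gives \<open>\<beta>' n\<close>; summing by columns
  gives finite inner sums evaluated by \<open>kern_sum\<close>. The \<open>N + 1\<close> shifted
  series are summed separately, which permits regrouping from \<open>r\<close> to
  \<open>m = r + i\<close>.\<close>

lemma new_pair_has_sum:
  "((\<lambda>m. \<Sum>i\<le>N. \<alpha> (m - int i) * new_coeff n m i) has_sum (\<Sum>\<^sub>\<infinity>j\<in>{..n}. kern n j * \<beta> j)) {..n}"
proof -
  define s where "s i = (\<Sum>\<^sub>\<infinity>m\<in>{..n}. \<alpha> (m - int i) * new_coeff n m i)" for i
  have s: "((\<lambda>m. \<alpha> (m - int i) * new_coeff n m i) has_sum s i) {..n}" for i
    unfolding s_def using new_coeff_summable by (rule has_sum_infsum)
  have s': "((\<lambda>r. \<alpha> r * new_coeff n (r + int i) i) has_sum s i) {..n}" for i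
  proof -
    have "((\<lambda>r. \<alpha> r * new_coeff n (r + int i) i) has_sum s i) {..n - int i}
       \<longleftrightarrow> ((\<lambda>m. \<alpha> (m - int i) * new_coeff n m i) has_sum s i) {..n}"
      by (rule has_sum_reindex_bij_witness[where j = "\<lambda>r. r + int i" and i = "\<lambda>m. m - int i"]) auto
    \<comment> \<open>The added indices have \<open>r + i > n\<close>, where
      \<open>new_coeff\<close> is zero.\<close>
    moreover have "((\<lambda>r. \<alpha> r * new_coeff n (r + int i) i) has_sum s i) {..n - int i}
       \<longleftrightarrow> ((\<lambda>r. \<alpha> r * new_coeff n (r + int i) i) has_sum s i) {..n}"
      by (rule has_sum_cong_neutral) (auto simp: new_coeff_def inv_qfac_neg)
    ultimately show ?thesis using s by simp
  qed
  define F where "F j r = kern n j * bailey_term q a \<alpha> j r" for j r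
  have S1: "(\<lambda>(j, r). F j r) summable_on Sigma {..n} (\<lambda>j. {..j})"
  proof -
    have "{(j, r). r \<le> j \<and> j \<le> n} = Sigma {..n} (\<lambda>j. {..j})" by auto
    then have "(\<lambda>x. norm ((\<lambda>(j, r). F j r) x)) summable_on Sigma {..n} (\<lambda>j. {..j})"
      using abs_conv by (simp add: F_def case_prod_unfold)
    then show ?thesis by (rule abs_summable_summable)
  qed
  \<comment> \<open>Swapping coordinates describes the region \<open>r \<le> j \<le> n\<close> by
    columns, each of them finite.\<close>
  have S2: "(\<lambda>(r, j). F j r) summable_on Sigma {..n} (\<lambda>r. {r..n})"
    using S1 by (subst summable_on_reindex_bij_witness[where j = prod.swap and i = prod.swap
         and T = "Sigma {..n} (\<lambda>j. {..j})" and h = "\<lambda>(j, r). F j r"]) auto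
  have "(\<Sum>\<^sub>\<infinity>j\<in>{..n}. kern n j * \<beta> j) = (\<Sum>\<^sub>\<infinity>j\<in>{..n}. \<Sum>\<^sub>\<infinity>r\<in>{..j}. F j r)"
    by (intro infsum_cong) (simp add: kern_beta_eq F_def)
  also have "\<dots> = infsum (\<lambda>(j, r). F j r) (Sigma {..n} (\<lambda>j. {..j}))"
    using infsum_Sigma_banach[OF S1] by simp
  also have "\<dots> = infsum (\<lambda>(r, j). F j r) (Sigma {..n} (\<lambda>r. {r..n}))"
    by (rule infsum_reindex_bij_witness[where j = prod.swap and i = prod.swap]) auto
  also have "\<dots> = (\<Sum>\<^sub>\<infinity>r\<in>{..n}. \<Sum>\<^sub>\<infinity>j\<in>{r..n}. F j r)"
    using infsum_Sigma_banach[OF S2] by simp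
  also have "\<dots> = (\<Sum>\<^sub>\<infinity>r\<in>{..n}. \<Sum>i\<le>N. \<alpha> r * new_coeff n (r + int i) i)"
  proof (rule infsum_cong)
    fix r assume "r \<in> {..n}"
    then have "(\<Sum>i\<le>N. \<alpha> r * new_coeff n (r + int i) i)
       = \<alpha> r * (\<Sum>j\<in>{r..n}. kern n j * (inv_qfac q (j - r) / qpoch q (a * q) (j + r)))"
      by (subst kern_sum) (simp_all add: sum_distrib_left)
    also have "\<dots> = (\<Sum>j\<in>{r..n}. F j r)"
      by (simp add: sum_distrib_left F_def bailey_term_eq[OF q] mult_ac)
    finally show "(\<Sum>\<^sub>\<infinity>j\<in>{r..n}. F j r) = (\<Sum>i\<le>N. \<alpha> r * new_coeff n (r + int i) i)" by simp
  qed
  also have "\<dots> = (\<Sum>i\<le>N. s i)"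
    by (intro infsumI has_sum_finite_sum s') simp
  finally have e: "(\<Sum>\<^sub>\<infinity>j\<in>{..n}. kern n j * \<beta> j) = (\<Sum>i\<le>N. s i)" .
  show ?thesis unfolding e by (intro has_sum_finite_sum s) simp
qed

end

end

(* The q-shifted factorials are quotients of infinite products; the gen_ assumptions say that
   none of the denominators occurring in the theorem vanishes.  The assumption abs_conv is the
   absolute convergence of the double series obtained by inserting the series for \<beta>(j) into
   the series for \<beta>'(n); it entails the absolute convergence of the series for \<beta>(n), of
   the series for \<beta>'(n), and of the series of the new pair. *)
theorem theorem3p2:
  fixes a q \<rho> \<sigma> :: complex and N :: nat
    and \<alpha> \<beta> \<alpha>' \<beta>' :: "int \<Rightarrow> complex"
  assumes q: "q \<noteq> 0" "norm q < 1"
    and nz: "a \<noteq> 0" "\<rho> \<noteq> 0" "\<sigma> \<noteq> 0"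
    and gen_a: "\<And>k::int. a * q powi k \<noteq> 1"
    and gen_rho: "\<And>k::int. \<rho> * q powi k \<noteq> 1"
    and gen_sigma: "\<And>k::int. \<sigma> * q powi k \<noteq> 1"
    and gen_a_rho: "\<And>k::int. a / \<rho> * q powi k \<noteq> 1"
    and gen_a_sigma: "\<And>k::int. a / \<sigma> * q powi k \<noteq> 1"
    and gen_a_rho_sigma: "\<And>k::nat. a * q powi (1 - int N) / (\<rho> * \<sigma>) * q ^ k \<noteq> 1"
    and pair: "bilateral_bailey_pair q a \<alpha> \<beta>"
    and alpha': "\<And>n. \<alpha>' n =
        qpoch q \<rho> n * qpoch q \<sigma> n * (a * q powi (1 - int N) / (\<rho> * \<sigma>)) powi n
        / (qpoch q (a * q powi (1 - int N) / \<rho>) n * qpoch q (a * q powi (1 - int N) / \<sigma>) n)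
        * (1 - a * q powi (2 * n - int N)) * qpoch q (a * q powi (1 - int N)) (int N)
        * (\<Sum>j=0..N. (-1) ^ j
             * (a ^ j * q powi ((2 * n - int N) * int j - int (j * (j + 1) div 2))
                / qpoch q (a * q powi (2 * n - int N - int j)) (int N + 1))
             * qbinom q N (int j) * \<alpha> (n - int j))"
    and beta': "\<And>n. \<beta>' n =
        (\<Sum>\<^sub>\<infinity>j\<in>{..n}.
           qpoch q \<rho> j * qpoch q \<sigma> j * qpoch q (a * q powi (1 - int N) / (\<rho> * \<sigma>)) (n - j)
           * (a * q powi (1 - int N) / (\<rho> * \<sigma>)) powi j
           / (qpoch q q (n - j)
              * (qpoch q (a * q powi (1 - int N) / \<rho>) n * qpoch q (a * q powi (1 - int N) / \<sigma>) n))
           * \<beta> j)"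
    and abs_conv: "\<And>n::int.
        (\<lambda>(j, r). norm (
           qpoch q \<rho> j * qpoch q \<sigma> j * qpoch q (a * q powi (1 - int N) / (\<rho> * \<sigma>)) (n - j)
           * (a * q powi (1 - int N) / (\<rho> * \<sigma>)) powi j
           / (qpoch q q (n - j)
              * (qpoch q (a * q powi (1 - int N) / \<rho>) n * qpoch q (a * q powi (1 - int N) / \<sigma>) n))
           * bailey_term q a \<alpha> j r)) summable_on {(j, r). r \<le> j \<and> j \<le> n}"
  shows "bilateral_bailey_pair q (a * q powi (- int N)) \<alpha>' \<beta>'"
proof -
  define b where "b = a * q powi (- int N)"
  define X where "X = b * q / (\<rho> * \<sigma>)"
  have bq: "a * q powi (1 - int N) = b * q"
    using q by (simp add: b_def power_int_diff power_int_minus field_simps)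
  \<comment> \<open>\<open>b q / x\<close> and \<open>a / x\<close> differ by a power of
    \<open>q\<close>, so the genericity of \<open>a / \<rho>\<close> and \<open>a / \<sigma>\<close>
    carries over.\<close>
  have b_div: "b * q / x = a / x * q powi (1 - int N)" for x
    by (simp flip: bq)
  interpret bailey_step q a \<rho> \<sigma> b X N
  proof
    have "q_generic q (a / \<rho>)" "q_generic q (a / \<sigma>)"
      unfolding q_generic_def using gen_a_rho gen_a_sigma by blast+
    then show "q_generic q (b * q / \<rho>)" "q_generic q (b * q / \<sigma>)"
      unfolding b_div using q_generic_shift[OF q(1)] by blast+
    show "X * q ^ k \<noteq> 1" for k using gen_a_rho_sigma[of k] unfolding X_def bq .
  qed (use q nz gen_a gen_rho gen_sigma in \<open>auto simp: q_generic_def b_def X_def\<close>)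
  have abs_conv': "(\<lambda>(j, r). norm (kern n j * bailey_term q a \<alpha> j r)) summable_on {(j, r). r \<le> j \<and> j \<le> n}" for n
    using abs_conv[of n] unfolding kern_def bq X_def[symmetric] .
  have beta: "\<beta>' n = (\<Sum>\<^sub>\<infinity>j\<in>{..n}. kern n j * \<beta> j)" for n
    using beta'[of n] unfolding kern_def bq X_def[symmetric] .
  have alpha: "\<alpha>' m = weight m * (\<Sum>i\<le>N. base_change_coeff q a N m i * \<alpha> (m - int i))" for m
    unfolding alpha' weight_def base_change_coeff_def bq X_def[symmetric] atMost_atLeast0 sum_distrib_left
    by (intro sum.cong) (simp_all add: mult_ac)
  show ?thesis
    unfolding bilateral_bailey_pair_def b_def[symmetric]
  proof
    fix n
    have "bailey_term q b \<alpha>' n = (\<lambda>m. \<Sum>i\<le>N. \<alpha> (m - int i) * new_coeff n m i)"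
      by (simp add: fun_eq_iff sum_distrib_left sum_distrib_right sum_divide_distrib bailey_term_eq[OF q] alpha new_coeff_def mult_ac)
    then have "(bailey_term q b \<alpha>' n has_sum \<beta>' n) {..n}"
      using new_pair_has_sum[OF pair abs_conv'[of n]] beta by simp
    then show "(\<lambda>k. bailey_term q b \<alpha>' n (n - int k)) sums \<beta>' n"
      by (rule has_sum_atMost_int_imp_sums)
  qed
qed

end
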